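(* Let $d\geq 4$ be even, let $V$ be a $d\times d$ unitary matrix with $V^T=-V$, and let $\mathcal{B}$ be the Breuer-Hall map on $d\times d$ complex matrices, $$\mathcal{B}(X)=\frac{1}{d-2}\left(\mathrm{Tr}(X)\,\mathbb{1}-X-VX^TV^\dagger\right).$$ Define the linear map on operators on $\mathbb{C}^d\otimes\mathbb{C}^d\otimes\mathbb{C}^d$ (parties $A,B,C$) $$\Phi_{\mathcal{B}}[\rho]=(\mathcal{B}_A\otimes I_{BC})[\rho]+(I_A\otimes\mathcal{B}_B\otimes I_C)[\rho]+(I_{AB}\otimes\mathcal{B}_C)[\rho]+c\,\mathrm{Tr}(\rho)\,\mathbb{1}.$$ For $c=\frac{2}{d}$, $\Phi_{\mathcal{B}}[\rho]\geq 0$ for every tripartite biseparable state $\rho$ on $\mathbb{C}^d\otimes\mathbb{C}^d\otimes\mathbb{C}^d$.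
   Context: $X^T$ is the transpose in the computational basis, $I$ denotes the identity map on operators of the indicated subsystems, $\mathbb{1}$ the identity operator, and the subscript on $\mathcal{B}$ indicates the party on which it acts. "$\geq 0$" means positive semidefinite. A state is a positive semidefinite operator of trace one. A tripartite state is biseparable if it is a finite convex combination of states, each of which is a product state $\rho_S\otimes\rho_{\bar S}$ with respect to some bipartition $S|\bar S$ of $\{A,B,C\}$ into two non-empty parts (different terms may use different bipartitions). *)

theory Defs
  imports "HOL-Analysis.Analysis"
begin

definition adj :: "complex^'n^'m \<Rightarrow> complex^'m^'n" where
  "adj M = (\<chi> i j. cnj (M $ j $ i))"

definition unitary :: "complex^'n^'n \<Rightarrow> bool" where
  "unitary U \<longleftrightarrow> adj U ** U = mat 1 \<and> U ** adj U = mat 1"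

text \<open>Membership in the nonnegative reals contains the claim that the quadratic form
  is real-valued; over the complex numbers this forces the matrix to be Hermitian.\<close>

definition psd :: "complex^'n^'n \<Rightarrow> bool" where
  "psd M \<longleftrightarrow> (\<forall>v. (\<Sum>i\<in>UNIV. cnj (v $ i) * (M *v v) $ i) \<in> \<real>\<^sub>\<ge>\<^sub>0)"

definition state :: "complex^'n^'n \<Rightarrow> bool" where
  "state \<rho> \<longleftrightarrow> psd \<rho> \<and> trace \<rho> = 1"

text \<open>Operators on a tensor product of coordinate spaces are matrices indexed by tuples of
  basis labels. The following are the tensor products of an operator on one party with an
  operator on the other two, with the factors placed at parties A, B, C in the right order.\<close>

definition tensor_A_BC ::
  "complex^'a^'a \<Rightarrow> complex^('b::finite \<times> 'c::finite)^('b \<times> 'c) \<Rightarrow>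
   complex^('a \<times> 'b \<times> 'c)^('a \<times> 'b \<times> 'c)" where
  "tensor_A_BC X Y = (\<chi> i j. case (i, j) of ((a, b, c), (a', b', c')) \<Rightarrow>
     X $ a $ a' * Y $ (b, c) $ (b', c'))"

definition tensor_B_AC ::
  "complex^'b^'b \<Rightarrow> complex^('a::finite \<times> 'c::finite)^('a \<times> 'c) \<Rightarrow>
   complex^('a \<times> 'b \<times> 'c)^('a \<times> 'b \<times> 'c)" where
  "tensor_B_AC X Y = (\<chi> i j. case (i, j) of ((a, b, c), (a', b', c')) \<Rightarrow>
     X $ b $ b' * Y $ (a, c) $ (a', c'))"

definition tensor_C_AB ::
  "complex^'c^'c \<Rightarrow> complex^('a::finite \<times> 'b::finite)^('a \<times> 'b) \<Rightarrow>
   complex^('a \<times> 'b \<times> 'c)^('a \<times> 'b \<times> 'c)" where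
  "tensor_C_AB X Y = (\<chi> i j. case (i, j) of ((a, b, c), (a', b', c')) \<Rightarrow>
     X $ c $ c' * Y $ (a, b) $ (a', b'))"

definition product_state :: "complex^('a::finite \<times> 'b::finite \<times> 'c::finite)^('a \<times> 'b \<times> 'c) \<Rightarrow> bool" where
  "product_state \<rho> \<longleftrightarrow>
     (\<exists>\<sigma> \<tau>. state \<sigma> \<and> state \<tau> \<and> \<rho> = tensor_A_BC \<sigma> \<tau>) \<or>
     (\<exists>\<sigma> \<tau>. state \<sigma> \<and> state \<tau> \<and> \<rho> = tensor_B_AC \<sigma> \<tau>) \<or>
     (\<exists>\<sigma> \<tau>. state \<sigma> \<and> state \<tau> \<and> \<rho> = tensor_C_AB \<sigma> \<tau>)"

definition biseparable :: "complex^('a::finite \<times> 'b::finite \<times> 'c::finite)^('a \<times> 'b \<times> 'c) \<Rightarrow> bool" where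
  "biseparable \<rho> \<longleftrightarrow>
     (\<exists>(m::nat) (p :: nat \<Rightarrow> real) \<sigma>.
        (\<forall>k<m. 0 \<le> p k \<and> product_state (\<sigma> k)) \<and> (\<Sum>k<m. p k) = 1 \<and>
        \<rho> = (\<Sum>k<m. p k *\<^sub>R \<sigma> k))"

text \<open>For a linear map \<open>L\<close> on the operators of one party, the following are its tensor products
  with the identity map on the operators of the other two: the basis labels of the other
  parties are frozen and \<open>L\<close> is applied to the resulting block. The lemmas \<open>on_A_tensor\<close>,
  \<open>on_B_tensor\<close>, \<open>on_C_tensor\<close> below give the characteristic action on product operators.\<close>

definition on_A ::
  "(complex^'a^'a \<Rightarrow> complex^'a^'a) \<Rightarrow>
   complex^('a \<times> 'b::finite \<times> 'c::finite)^('a \<times> 'b \<times> 'c) \<Rightarrow>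
   complex^('a \<times> 'b \<times> 'c)^('a \<times> 'b \<times> 'c)" where
  "on_A L \<rho> = (\<chi> i j. case (i, j) of ((a, b, c), (a', b', c')) \<Rightarrow>
     L (\<chi> x y. \<rho> $ (x, b, c) $ (y, b', c')) $ a $ a')"

definition on_B ::
  "(complex^'b^'b \<Rightarrow> complex^'b^'b) \<Rightarrow>
   complex^('a::finite \<times> 'b \<times> 'c::finite)^('a \<times> 'b \<times> 'c) \<Rightarrow>
   complex^('a \<times> 'b \<times> 'c)^('a \<times> 'b \<times> 'c)" where
  "on_B L \<rho> = (\<chi> i j. case (i, j) of ((a, b, c), (a', b', c')) \<Rightarrow>
     L (\<chi> x y. \<rho> $ (a, x, c) $ (a', y, c')) $ b $ b')"

definition on_C ::
  "(complex^'c^'c \<Rightarrow> complex^'c^'c) \<Rightarrow>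
   complex^('a::finite \<times> 'b::finite \<times> 'c)^('a \<times> 'b \<times> 'c) \<Rightarrow>
   complex^('a \<times> 'b \<times> 'c)^('a \<times> 'b \<times> 'c)" where
  "on_C L \<rho> = (\<chi> i j. case (i, j) of ((a, b, c), (a', b', c')) \<Rightarrow>
     L (\<chi> x y. \<rho> $ (a, b, x) $ (a', b', y)) $ c $ c')"

text \<open>Note that \<open>mat z\<close> is the scalar matrix \<open>z\<close> times the identity.\<close>

definition breuer_hall :: "complex^'n^'n \<Rightarrow> complex^'n^'n \<Rightarrow> complex^'n^'n" where
  "breuer_hall V X =
     (1 / (real CARD('n) - 2)) *\<^sub>R (mat (trace X) - X - V ** transpose X ** adj V)"

definition Phi_BH ::
  "complex^'n^'n \<Rightarrow> real \<Rightarrow>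
   complex^('n \<times> 'n \<times> 'n)^('n \<times> 'n \<times> 'n) \<Rightarrow> complex^('n \<times> 'n \<times> 'n)^('n \<times> 'n \<times> 'n)" where
  "Phi_BH V c \<rho> =
     on_A (breuer_hall V) \<rho> + on_B (breuer_hall V) \<rho> + on_C (breuer_hall V) \<rho>
       + c *\<^sub>R mat (trace \<rho>)"

lemma breuer_hall_add:
  fixes V :: "complex^'n^'n"
  shows "breuer_hall V (X + Y) = breuer_hall V X + breuer_hall V Y"
proof -
  have "V ** transpose (X + Y) ** adj V = V ** transpose X ** adj V + V ** transpose Y ** adj V"
    by (simp add: vec_eq_iff matrix_matrix_mult_def transpose_def sum.distrib algebra_simps)
  moreover have "mat (trace (X + Y)) = (mat (trace X) + mat (trace Y) :: complex^'n^'n)"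
    by (simp add: vec_eq_iff mat_def trace_add)
  ultimately show ?thesis
    by (simp add: breuer_hall_def algebra_simps)
qed

lemma breuer_hall_scale:
  "breuer_hall V (\<chi> x y. X $ x $ y * z) = (\<chi> x y. breuer_hall V X $ x $ y * z)"
proof -
  have "(V ** transpose (\<chi> x y. X $ x $ y * z) ** adj V) $ i $ j =
      (V ** transpose X ** adj V) $ i $ j * z" for i j
    by (simp add: matrix_matrix_mult_def transpose_def sum_distrib_left sum_distrib_right mult_ac)
  moreover have "trace (\<chi> x y. X $ x $ y * z) = trace X * z"
    by (simp add: trace_def sum_distrib_right)
  ultimately show ?thesis
    by (simp add: breuer_hall_def vec_eq_iff mat_def algebra_simps)
qed

lemma on_A_tensor:
  assumes "\<And>X z. L (\<chi> x y. X $ x $ y * z) = (\<chi> x y. L X $ x $ y * z)"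
  shows "on_A L (tensor_A_BC X Y) = tensor_A_BC (L X) Y"
  by (simp add: on_A_def tensor_A_BC_def vec_eq_iff assms)

lemma on_B_tensor:
  assumes "\<And>X z. L (\<chi> x y. X $ x $ y * z) = (\<chi> x y. L X $ x $ y * z)"
  shows "on_B L (tensor_B_AC X Y) = tensor_B_AC (L X) Y"
  by (simp add: on_B_def tensor_B_AC_def vec_eq_iff assms)

lemma on_C_tensor:
  assumes "\<And>X z. L (\<chi> x y. X $ x $ y * z) = (\<chi> x y. L X $ x $ y * z)"
  shows "on_C L (tensor_C_AB X Y) = tensor_C_AB (L X) Y"
  by (simp add: on_C_def tensor_C_AB_def vec_eq_iff assms)

end

theory Submission
  imports Defs
begin

text \<open>The Breuer-Hall map \<open>B\<close> is positive, and \<open>B + id / d\<close> is even completely positive.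
  If \<open>\<rho>\<close> is a product across \<open>A | BC\<close>, then \<open>B\<^sub>A \<rho> \<ge> 0\<close> by positivity, while \<open>B\<^sub>B \<rho>\<close> and \<open>B\<^sub>C \<rho>\<close> are
  each at least \<open>- \<rho> / d\<close> by complete positivity; their total defect \<open>2 \<rho> / d\<close> is absorbed by
  \<open>(2 / d) Tr \<rho>\<close> times the identity. The other bipartitions are symmetric, and the general case
  follows by convexity.\<close>

section \<open>Sesquilinear forms and the cone of positive semidefinite matrices\<close>

definition sesq :: "complex^'n^'n \<Rightarrow> complex^'n \<Rightarrow> complex^'n \<Rightarrow> complex" where
  "sesq M v w = (\<Sum>i\<in>UNIV. \<Sum>j\<in>UNIV. cnj (v $ i) * M $ i $ j * w $ j)"

lemma psd_iff_sesq: "psd M \<longleftrightarrow> (\<forall>v. sesq M v v \<in> \<real>\<^sub>\<ge>\<^sub>0)"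
  by (simp add: psd_def sesq_def matrix_vector_mult_def sum_distrib_left mult.assoc)

lemma psd_sesq: "psd M \<Longrightarrow> sesq M v v \<in> \<real>\<^sub>\<ge>\<^sub>0"
  by (simp add: psd_iff_sesq)

lemma sesq_add_left: "sesq M (v + v') w = sesq M v w + sesq M v' w"
  by (simp add: sesq_def algebra_simps sum.distrib)

lemma sesq_add_right: "sesq M v (w + w') = sesq M v w + sesq M v w'"
  by (simp add: sesq_def algebra_simps sum.distrib)

lemma sesq_scale_left: "sesq M (t *s v) w = cnj t * sesq M v w"
  by (simp add: sesq_def sum_distrib_left mult_ac)

lemma sesq_scale_right: "sesq M v (t *s w) = t * sesq M v w"
  by (simp add: sesq_def sum_distrib_left mult_ac)

lemma sesq_add_matrix: "sesq (M + N) v w = sesq M v w + sesq N v w"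
  by (simp add: sesq_def algebra_simps sum.distrib)

lemma sesq_scaleR_matrix: "sesq (c *\<^sub>R M) v w = c *\<^sub>R sesq M v w"
  by (simp add: sesq_def scaleR_sum_right)

lemma sesq_axis_left: "sesq M (axis i 1) w = (\<Sum>j\<in>UNIV. M $ i $ j * w $ j)"
proof -
  have "sesq M (axis i 1) w = (\<Sum>k\<in>UNIV. if k = i then \<Sum>j\<in>UNIV. M $ i $ j * w $ j else 0)"
    unfolding sesq_def by (rule sum.cong) (auto simp: axis_def)
  then show ?thesis by simp
qed

lemma sesq_axis: "sesq M (axis i 1) (axis j 1) = M $ i $ j"
  unfolding sesq_axis_left by (simp add: axis_def if_distrib cong: if_cong)

lemma psd_zero: "psd 0"
  by (simp add: psd_iff_sesq sesq_def)

lemma psd_add: "psd M \<Longrightarrow> psd N \<Longrightarrow> psd (M + N)"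
  by (simp add: psd_iff_sesq sesq_add_matrix)

lemma psd_scaleR: "0 \<le> c \<Longrightarrow> psd M \<Longrightarrow> psd (c *\<^sub>R M)"
  by (simp add: psd_iff_sesq sesq_scaleR_matrix scaleR_conv_of_real[where 'a = complex])

lemma psd_sum: "(\<And>k. k \<in> S \<Longrightarrow> psd (F k)) \<Longrightarrow> psd (\<Sum>k\<in>S. F k)"
  by (induction S rule: infinite_finite_induct) (auto simp: psd_zero psd_add)

text \<open>Polarization: the quadratic form is real at \<open>e_i + t e_j\<close>. Taking
  \<open>t = 1\<close> matches the imaginary parts of the two off-diagonal entries, and
  \<open>t = i\<close> (the imaginary unit) matches their real parts.\<close>

lemma psd_hermitian:
  assumes "psd M"
  shows "M $ j $ i = cnj (M $ i $ j)"
proof -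
  have q: "sesq M (axis i 1 + t *s axis j 1) (axis i 1 + t *s axis j 1)
      = M $ i $ i + t * M $ i $ j + cnj t * M $ j $ i + cnj t * t * M $ j $ j" for t
    by (simp add: sesq_add_left sesq_add_right sesq_scale_left sesq_scale_right sesq_axis algebra_simps)
  have r: "Im (sesq M v v) = 0" for v
    using psd_sesq[OF assms, of v] by (simp add: complex_nonneg_Reals_iff)
  have d: "Im (M $ k $ k) = 0" for k
    using r[of "axis k 1"] by (simp add: sesq_axis)
  show ?thesis
    using r[of "axis i 1 + 1 *s axis j 1"] r[of "axis i 1 + \<i> *s axis j 1"] d[of i] d[of j]
    unfolding q by (simp add: complex_eq_iff)
qed

text \<open>With \<open>M $ i $ i = 0\<close> the form at \<open>e_j + t e_i\<close> has no term
  quadratic in \<open>t\<close>, so a nonzero off-diagonal entry would let it become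
  negative.\<close>

lemma psd_zero_diagonal:
  assumes "psd M" "M $ i $ i = 0"
  shows "M $ i $ j = 0"
proof (rule ccontr)
  assume nz: "M $ i $ j \<noteq> 0"
  define z where "z = M $ i $ j"
  \<comment> \<open>Tuned so that the form, whose real part is
    \<open>Re (M $ j $ j) - 2 * r * (cmod z)^2\<close>, comes out as -1.\<close>
  define r where "r = (Re (M $ j $ j) + 1) / (2 * (cmod z)\<^sup>2)"
  have zz: "z * cnj z = of_real ((cmod z)\<^sup>2)"
    by (rule complex_norm_square [symmetric])
  define t where "t = - (of_real r * z)"
  have "sesq M (axis j 1 + t *s axis i 1) (axis j 1 + t *s axis i 1)
      = M $ j $ j + t * cnj z + cnj t * z"
    using assms(2) psd_hermitian[OF assms(1), of j i]
    by (simp add: sesq_add_left sesq_add_right sesq_scale_left sesq_scale_right sesq_axis z_def)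
  also have "\<dots> = M $ j $ j - of_real (2 * r) * (z * cnj z)"
    by (simp add: t_def algebra_simps)
  also have "\<dots> = M $ j $ j - of_real (2 * r * (cmod z)\<^sup>2)"
    unfolding zz by simp
  finally have "sesq M (axis j 1 + t *s axis i 1) (axis j 1 + t *s axis i 1)
      = M $ j $ j - of_real (2 * r * (cmod z)\<^sup>2)" .
  moreover have "2 * r * (cmod z)\<^sup>2 = Re (M $ j $ j) + 1"
    using nz by (simp add: r_def z_def)
  ultimately have "Re (sesq M (axis j 1 + t *s axis i 1) (axis j 1 + t *s axis i 1)) = - 1"
    by simp
  then show False
    using psd_sesq[OF assms(1)] by (metis complex_nonneg_Reals_iff neg_0_le_iff_le not_one_le_zero)
qed

section \<open>Rank-one decomposition by elimination of pivots\<close>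

text \<open>Completing the square: the form of the complement at \<open>v\<close> is the form of
  \<open>M\<close> at a shift of \<open>v\<close> along \<open>e_s\<close>.\<close>

lemma psd_schur_complement:
  assumes "psd M"
  shows "psd (\<chi> i j. M $ i $ j - M $ i $ s * M $ s $ j / M $ s $ s)"
proof (cases "M $ s $ s = 0")
  \<comment> \<open>Division by zero yields 0, so the complement is \<open>M\<close> itself.\<close>
  case True
  then show ?thesis using assms by simp
next
  case False
  define m where "m = M $ s $ s"
  have m: "cnj m = m" using psd_hermitian[OF assms, of s s] by (simp add: m_def)
  show ?thesis
    unfolding psd_iff_sesq
  proof
    fix v
    define y where "y = sesq M (axis s 1) v"
    \<comment> \<open>The minimizer over \<open>t\<close> of the form of \<open>M\<close> at
      \<open>v + t e_s\<close>.\<close>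
    define t where "t = - y / m"
    have y: "y = (\<Sum>j\<in>UNIV. M $ s $ j * v $ j)"
      by (simp add: y_def sesq_axis_left)
    have cy: "cnj y = (\<Sum>i\<in>UNIV. cnj (v $ i) * M $ i $ s)"
      by (simp add: y psd_hermitian[OF assms, of _ s] mult.commute)
    have cyy: "cnj y * y = (\<Sum>i\<in>UNIV. \<Sum>j\<in>UNIV. (cnj (v $ i) * M $ i $ s) * (M $ s $ j * v $ j))"
      unfolding cy by (subst y) (rule sum_product)
    have y': "sesq M v (axis s 1) = cnj y"
      unfolding cy sesq_def by (simp add: axis_def if_distrib cong: if_cong)
    have "sesq (\<chi> i j. M $ i $ j - M $ i $ s * M $ s $ j / M $ s $ s) v v
        = sesq M v v - (\<Sum>i\<in>UNIV. \<Sum>j\<in>UNIV. (cnj (v $ i) * M $ i $ s) * (M $ s $ j * v $ j) / m)"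
      by (simp add: sesq_def algebra_simps sum_subtractf m_def)
    also have "(\<Sum>i\<in>UNIV. \<Sum>j\<in>UNIV. (cnj (v $ i) * M $ i $ s) * (M $ s $ j * v $ j) / m)
        = cnj y * y / m"
      unfolding cyy sum_divide_distrib ..
    also have "sesq M v v - cnj y * y / m
        = sesq M v v + t * cnj y + cnj t * y + cnj t * t * m"
      using False m by (simp add: t_def m_def[symmetric] field_simps)
    also have "\<dots> = sesq M (v + t *s axis s 1) (v + t *s axis s 1)"
      by (simp add: sesq_add_left sesq_add_right sesq_scale_left sesq_scale_right sesq_axis
          y' y_def[symmetric] m_def[symmetric] algebra_simps)
    finally show "sesq (\<chi> i j. M $ i $ j - M $ i $ s * M $ s $ j / M $ s $ s) v v \<in> \<real>\<^sub>\<ge>\<^sub>0"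
      using psd_sesq[OF assms] by simp
  qed
qed

text \<open>Cholesky elimination, one row at a time.\<close>

lemma psd_rank_one_sum_on:
  fixes M :: "complex^'n^'n"
  assumes "finite S" "psd M" "\<And>i j. i \<notin> S \<Longrightarrow> M $ i $ j = 0"
  shows "\<exists>u :: 'n \<Rightarrow> complex^'n. \<forall>i j. M $ i $ j = (\<Sum>k\<in>S. u k $ i * cnj (u k $ j))"
  using assms
proof (induction S arbitrary: M rule: finite_induct)
  case empty
  then show ?case by simp
next
  case (insert s S)
  define M' where "M' = (\<chi> i j. M $ i $ j - M $ i $ s * M $ s $ j / M $ s $ s)"
  note herm = psd_hermitian[OF insert.prems(1)]
  \<comment> \<open>Row \<open>s\<close> vanishes as well: a nonzero pivot cancels, and a zero pivot
    leaves \<open>M $ s $ j\<close>, which is 0 because the diagonal entry is.\<close>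
  have "M' $ i $ j = 0" if "i \<notin> S" for i j
  proof (cases "i = s")
    case True
    then show ?thesis
      using psd_zero_diagonal[OF insert.prems(1), of s j] by (auto simp: M'_def)
  qed (use that insert.prems(2) in \<open>simp add: M'_def\<close>)
  moreover have "psd M'"
    unfolding M'_def by (rule psd_schur_complement[OF insert.prems(1)])
  ultimately obtain u :: "'n \<Rightarrow> complex^'n"
    where u: "\<And>i j. M' $ i $ j = (\<Sum>k\<in>S. u k $ i * cnj (u k $ j))"
    using insert.IH[of M'] by auto
  define r where "r = sqrt (Re (M $ s $ s))"
  \<comment> \<open>The new vector is the pivot column over the square root of the pivot. For a zero
    pivot both this vector and the subtracted quotient are 0 by the convention on division.\<close>
  define w where "w = u(s := \<chi> i. M $ i $ s / of_real r)"
  have "M $ s $ s \<in> \<real>\<^sub>\<ge>\<^sub>0"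
    using psd_sesq[OF insert.prems(1), of "axis s 1"] by (simp add: sesq_axis)
  then have r: "M $ s $ s = of_real r * of_real r"
    by (auto simp: complex_nonneg_Reals_iff complex_eq_iff r_def)
  have "M $ i $ j = (\<Sum>k\<in>insert s S. w k $ i * cnj (w k $ j))" for i j
  proof -
    have "(\<Sum>k\<in>S. w k $ i * cnj (w k $ j)) = M' $ i $ j"
      unfolding u using insert.hyps(2) by (intro sum.cong) (auto simp: w_def)
    moreover have "w s $ i * cnj (w s $ j) = M $ i $ s * M $ s $ j / M $ s $ s"
      using herm[of s j] by (simp add: w_def r)
    ultimately show ?thesis
      using insert.hyps by (simp add: M'_def)
  qed
  then show ?case by blast
qed

lemma psd_rank_one_sum:
  fixes M :: "complex^'n^'n"
  assumes "psd M"
  obtains u :: "'n \<Rightarrow> complex^'n" where "\<And>i j. M $ i $ j = (\<Sum>k\<in>UNIV. u k $ i * cnj (u k $ j))"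
  using psd_rank_one_sum_on[OF finite_class.finite_UNIV assms] by auto

section \<open>Inner products, Bessel's inequality and the bound of an operator by its trace\<close>

definition cinner :: "complex^'n \<Rightarrow> complex^'n \<Rightarrow> complex" where
  "cinner v w = (\<Sum>i\<in>UNIV. cnj (v $ i) * w $ i)"

lemma cinner_cnj: "cnj (cinner v w) = cinner w v"
  by (simp add: cinner_def mult.commute)

lemma cinner_self: "cinner v v = of_real (\<Sum>i\<in>UNIV. (cmod (v $ i))\<^sup>2)"
  by (simp add: cinner_def complex_norm_square mult.commute del: of_real_power)

lemma cinner_self_nonneg: "cinner v v \<in> \<real>\<^sub>\<ge>\<^sub>0"
  unfolding cinner_self nonneg_Reals_of_real_iff by (intro sum_nonneg) simp

lemma cinner_eq_0: "cinner v v = 0 \<Longrightarrow> v = 0"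
  unfolding cinner_self of_real_eq_0_iff by (simp add: sum_nonneg_eq_0_iff vec_eq_iff)

lemma cinner_bilinear:
  "cinner (v - v') w = cinner v w - cinner v' w"
  "cinner v (w - w') = cinner v w - cinner v w'"
  "cinner (v + v') w = cinner v w + cinner v' w"
  "cinner v (w + w') = cinner v w + cinner v w'"
  "cinner (t *s v) w = cnj t * cinner v w"
  "cinner v (t *s w) = t * cinner v w"
  by (simp_all add: cinner_def algebra_simps sum_subtractf sum.distrib sum_distrib_left)

text \<open>Bessel's inequality for two orthogonal vectors of equal norm, multiplied through by that
  squared norm so that nothing has to be normalized. Admitting \<open>y = 0\<close> lets the same
  argument yield Cauchy-Schwarz.\<close>

lemma bessel_two:
  assumes "cinner x y = 0" "cinner y y = 0 \<or> cinner y y = cinner x x"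
  shows "cinner u u * cinner x x - cinner x u * cinner u x - cinner y u * cinner u y \<in> \<real>\<^sub>\<ge>\<^sub>0"
proof (cases "x = 0")
  case True
  then have "cinner y y = 0" using assms by (auto simp: cinner_def)
  then have "y = 0" by (rule cinner_eq_0)
  then show ?thesis using True by (simp add: cinner_def)
next
  case False
  define r where "r = cinner x x"
  have yx: "cinner y x = 0" using assms(1) cinner_cnj[of x y] by simp
  have r0: "r \<noteq> 0" using False cinner_eq_0 r_def by auto
  have cr: "cnj r = r" by (simp add: r_def cinner_cnj)
  have rnn: "r \<in> \<real>\<^sub>\<ge>\<^sub>0" by (simp add: r_def cinner_self_nonneg)
  \<comment> \<open>This is \<open>r\<close> times the component of \<open>u\<close> orthogonal to
    \<open>x\<close> and \<open>y\<close>; its squared norm is \<open>r\<close> times the expression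
    in question.\<close>
  define z where "z = r *s u - cinner x u *s x - cinner y u *s y"
  have yy: "cinner y y * cinner y u = r * cinner y u"
    using assms(2) cinner_eq_0[of y] by (auto simp: r_def cinner_def)
  have "cinner z z = r * (r * cinner u u - cinner x u * cinner u x - cinner y u * cinner u y)
      + (cinner y y * cinner y u - r * cinner y u) * cinner u y"
    unfolding z_def cinner_bilinear cinner_cnj assms(1) yx cr r_def[symmetric] complex_cnj_diff
      complex_cnj_mult
    by algebra
  then have "cinner z z = r * (r * cinner u u - cinner x u * cinner u x - cinner y u * cinner u y)"
    using yy by simp
  then have "cinner u u * r - cinner x u * cinner u x - cinner y u * cinner u y
      = inverse r * cinner z z"
    using r0 by (simp add: field_simps)
  also have "\<dots> \<in> \<real>\<^sub>\<ge>\<^sub>0"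
    using rnn by (intro nonneg_Reals_mult_I nonneg_Reals_inverse_I cinner_self_nonneg)
  finally show ?thesis by (simp add: r_def)
qed

lemma cauchy_schwarz_cinner: "cinner u u * cinner x x - cinner x u * cinner u x \<in> \<real>\<^sub>\<ge>\<^sub>0"
  using bessel_two[of x 0 u] by (simp add: cinner_def)

lemma sesq_rank_one_sum:
  assumes "\<And>i j. M $ i $ j = (\<Sum>k\<in>K. u k $ i * cnj (u k $ j))"
  shows "sesq M v w = (\<Sum>k\<in>K. cinner v (u k) * cinner (u k) w)"
proof -
  have "(\<Sum>k\<in>K. cinner v (u k) * cinner (u k) w)
      = (\<Sum>k\<in>K. \<Sum>i\<in>UNIV. \<Sum>j\<in>UNIV. cnj (v $ i) * (u k $ i * cnj (u k $ j)) * w $ j)"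
    unfolding cinner_def sum_product by (simp add: mult.assoc)
  also have "\<dots> = (\<Sum>i\<in>UNIV. \<Sum>k\<in>K. \<Sum>j\<in>UNIV. cnj (v $ i) * (u k $ i * cnj (u k $ j)) * w $ j)"
    by (rule sum.swap)
  also have "\<dots> = (\<Sum>i\<in>UNIV. \<Sum>j\<in>UNIV. \<Sum>k\<in>K. cnj (v $ i) * (u k $ i * cnj (u k $ j)) * w $ j)"
    by (rule sum.cong[OF refl], rule sum.swap)
  also have "\<dots> = sesq M v w"
    by (simp add: sesq_def assms sum_distrib_left sum_distrib_right)
  finally show ?thesis ..
qed

lemma trace_rank_one_sum:
  assumes "\<And>i j. M $ i $ j = (\<Sum>k\<in>K. u k $ i * cnj (u k $ j))"
  shows "trace M = (\<Sum>k\<in>K. cinner (u k) (u k))"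
  unfolding trace_def assms cinner_def by (subst sum.swap) (simp add: mult.commute)

lemma sesq_mat: "sesq (mat z) v w = z * cinner v w"
proof -
  have "sesq (mat z) v w = (\<Sum>i\<in>UNIV. z * (cnj (v $ i) * w $ i))"
    unfolding sesq_def
  proof (rule sum.cong)
    fix i
    have "(\<Sum>j\<in>UNIV. cnj (v $ i) * mat z $ i $ j * w $ j)
        = (\<Sum>j\<in>UNIV. if j = i then z * (cnj (v $ i) * w $ i) else 0)"
      by (rule sum.cong) (auto simp: mat_def)
    then show "(\<Sum>j\<in>UNIV. cnj (v $ i) * mat z $ i $ j * w $ j) = z * (cnj (v $ i) * w $ i)"
      by simp
  qed simp
  then show ?thesis by (simp add: cinner_def sum_distrib_left)
qed

lemma sesq_diff_matrix: "sesq (M - N) v w = sesq M v w - sesq N v w"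
  by (simp add: sesq_def algebra_simps sum_subtractf)

lemma nonneg_Reals_sum: "(\<And>k. k \<in> S \<Longrightarrow> f k \<in> \<real>\<^sub>\<ge>\<^sub>0) \<Longrightarrow> (\<Sum>k\<in>S. f k) \<in> \<real>\<^sub>\<ge>\<^sub>0"
  by (induction S rule: infinite_finite_induct) auto

text \<open>Cauchy-Schwarz applied to each rank-one term. This is what lets the identity term of the
  map absorb a multiple of the state.\<close>

lemma psd_trace_minus:
  fixes M :: "complex^'n^'n"
  assumes "psd M"
  shows "psd (mat (trace M) - M)"
proof -
  obtain u :: "'n \<Rightarrow> complex^'n"
    where u: "\<And>i j. M $ i $ j = (\<Sum>k\<in>UNIV. u k $ i * cnj (u k $ j))"
    using psd_rank_one_sum[OF assms] by blast
  show ?thesis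
    unfolding psd_iff_sesq sesq_diff_matrix sesq_mat sesq_rank_one_sum[OF u]
      trace_rank_one_sum[OF u] sum_distrib_right sum_subtractf[symmetric]
    by (intro allI nonneg_Reals_sum cauchy_schwarz_cinner)
qed

section \<open>Positivity of the Breuer-Hall map\<close>

lemma unitary_rows:
  assumes "unitary V"
  shows "(\<Sum>k\<in>UNIV. V $ i $ k * cnj (V $ j $ k)) = (if i = j then 1 else 0)"
proof -
  have "(V ** adj V) $ i $ j = (mat 1 :: complex^'a^'a) $ i $ j"
    using assms by (simp add: unitary_def)
  then show ?thesis by (simp add: matrix_matrix_mult_def adj_def mat_def)
qed

lemma antisymmetric_entry:
  assumes "transpose V = - V"
  shows "V $ i $ j = - (V $ j $ i)"
proof -
  have "transpose V $ j $ i = (- V) $ j $ i" by (simp only: assms)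
  then show ?thesis by (simp add: transpose_def)
qed

lemma sum_UNIV_pair: "(\<Sum>z\<in>UNIV. f z) = (\<Sum>a\<in>UNIV. \<Sum>b\<in>UNIV. f (a, b))"
  unfolding sum.cartesian_product UNIV_Times_UNIV by (simp add: case_prod_unfold)

text \<open>Moving \<open>V\<close> onto the vector gives the form of the transpose of
  \<open>X\<close> at \<open>adj V *v v\<close>. That equals the form of \<open>X\<close> at the
  complex conjugate of this vector.\<close>

lemma sesq_conj_transpose:
  "sesq (V ** transpose X ** adj V) v v
    = sesq X (\<chi> i. \<Sum>a\<in>UNIV. V $ a $ i * cnj (v $ a)) (\<chi> i. \<Sum>a\<in>UNIV. V $ a $ i * cnj (v $ a))"
  (is "?L = ?R")
proof -
  define f where "f a b j i = cnj (v $ a) * V $ a $ i * X $ j $ i * cnj (V $ b $ j) * v $ b" for a b j i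
  have "?L = (\<Sum>a\<in>UNIV. \<Sum>b\<in>UNIV. \<Sum>j\<in>UNIV. \<Sum>i\<in>UNIV. f a b j i)"
    by (simp add: sesq_def matrix_matrix_mult_def transpose_def adj_def f_def
        sum_distrib_left sum_distrib_right mult.assoc)
  \<comment> \<open>Merging the nested sums into one sum over tuples makes the reordering a single
    bijective reindexing.\<close>
  also have "\<dots> = (\<Sum>(a, b, j, i)\<in>UNIV. f a b j i)"
    by (simp only: sum_UNIV_pair prod.case)
  also have "\<dots> = (\<Sum>(j, i, b, a)\<in>UNIV. f a b j i)"
    by (rule sum.reindex_bij_witness[where i = "\<lambda>(j, i, b, a). (a, b, j, i)"
          and j = "\<lambda>(a, b, j, i). (j, i, b, a)"]) auto
  also have "\<dots> = (\<Sum>j\<in>UNIV. \<Sum>i\<in>UNIV. \<Sum>b\<in>UNIV. \<Sum>a\<in>UNIV. f a b j i)"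
    by (simp only: sum_UNIV_pair prod.case)
  also have "\<dots> = (\<Sum>j\<in>UNIV. \<Sum>i\<in>UNIV. X $ j $ i *
      ((\<Sum>b\<in>UNIV. cnj (V $ b $ j) * v $ b) * (\<Sum>a\<in>UNIV. V $ a $ i * cnj (v $ a))))"
    by (simp only: sum_product) (simp add: sum_distrib_left f_def mult_ac)
  also have "\<dots> = ?R"
    by (simp add: sesq_def mult_ac)
  finally show ?thesis .
qed

text \<open>The vectors \<open>v\<close> and \<open>V\<^sup>T cnj v\<close> have equal norm and, by antisymmetry of \<open>V\<close>, are orthogonal.\<close>

lemma psd_breuer_hall:
  fixes V :: "complex^'n^'n"
  assumes "unitary V" "transpose V = - V" "CARD('n) \<ge> 2" "psd X"
  shows "psd (breuer_hall V X)"
proof -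
  obtain u :: "'n \<Rightarrow> complex^'n"
    where u: "\<And>i j. X $ i $ j = (\<Sum>k\<in>UNIV. u k $ i * cnj (u k $ j))"
    using psd_rank_one_sum[OF assms(4)] by blast
  have "sesq (mat (trace X) - X - V ** transpose X ** adj V) v v \<in> \<real>\<^sub>\<ge>\<^sub>0" for v
  proof -
    define y where "y = (\<chi> i. \<Sum>a\<in>UNIV. V $ a $ i * cnj (v $ a))"
    have "cinner y v = (\<Sum>i\<in>UNIV. \<Sum>a\<in>UNIV. cnj (V $ a $ i) * v $ a * v $ i)"
      by (simp add: cinner_def y_def sum_distrib_right)
    also have "\<dots> = (\<Sum>a\<in>UNIV. \<Sum>i\<in>UNIV. cnj (V $ a $ i) * v $ a * v $ i)"
      by (rule sum.swap)
    \<comment> \<open>Antisymmetry of \<open>V\<close> makes \<open>cinner y v\<close> equal to its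
      own negative.\<close>
    also have "\<dots> = - (\<Sum>a\<in>UNIV. \<Sum>i\<in>UNIV. cnj (V $ i $ a) * v $ i * v $ a)"
      by (subst antisymmetric_entry[OF assms(2)]) (simp add: sum_negf mult_ac)
    also have "(\<Sum>a\<in>UNIV. \<Sum>i\<in>UNIV. cnj (V $ i $ a) * v $ i * v $ a) = cinner y v"
      by (simp add: cinner_def y_def sum_distrib_right)
    finally have "cinner y v = 0" by simp
    then have vy: "cinner v y = 0" using cinner_cnj[of y v] by simp
    have "cinner y y = (\<Sum>i\<in>UNIV. \<Sum>a\<in>UNIV. \<Sum>b\<in>UNIV.
        (cnj (V $ a $ i) * v $ a) * (V $ b $ i * cnj (v $ b)))"
      by (simp add: cinner_def y_def sum_product)
    also have "\<dots> = (\<Sum>a\<in>UNIV. \<Sum>i\<in>UNIV. \<Sum>b\<in>UNIV.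
        (cnj (V $ a $ i) * v $ a) * (V $ b $ i * cnj (v $ b)))"
      by (rule sum.swap)
    also have "\<dots> = (\<Sum>a\<in>UNIV. \<Sum>b\<in>UNIV. \<Sum>i\<in>UNIV.
        (cnj (V $ a $ i) * v $ a) * (V $ b $ i * cnj (v $ b)))"
      by (rule sum.cong[OF refl], rule sum.swap)
    also have "\<dots> = (\<Sum>a\<in>UNIV. \<Sum>b\<in>UNIV.
        (v $ a * cnj (v $ b)) * (\<Sum>i\<in>UNIV. V $ b $ i * cnj (V $ a $ i)))"
      by (simp add: sum_distrib_left mult_ac)
    also have "\<dots> = cinner v v"
      by (simp add: unitary_rows[OF assms(1)] cinner_def if_distrib mult.commute cong: if_cong)
    finally have yy: "cinner y y = cinner v v" .
    \<comment> \<open>After the rank-one decomposition of \<open>X\<close>, each summand is the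
      expression of \<open>bessel_two\<close> for the pair \<open>v\<close>, \<open>y\<close> and
      the vector \<open>u k\<close>.\<close>
    show ?thesis
      unfolding sesq_diff_matrix sesq_conj_transpose y_def[symmetric] sesq_mat
        trace_rank_one_sum[OF u] sesq_rank_one_sum[OF u] sum_distrib_right sum_subtractf[symmetric]
      by (intro nonneg_Reals_sum bessel_two vy disjI2 yy)
  qed
  then show ?thesis
    \<comment> \<open>The prefactor is nonnegative also in dimension 2, where it is 1/0 = 0.\<close>
    unfolding breuer_hall_def using assms(3) by (intro psd_scaleR) (auto simp: psd_iff_sesq)
qed

section \<open>Kronecker products, Kraus maps and complete positivity of the shifted Breuer-Hall
  map\<close>

text \<open>A rank-one decomposition of \<open>Y\<close> splits the form at \<open>v\<close> into
  forms of \<open>X\<close> at the vectors \<open>x k\<close>, obtained by contracting the second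
  factor of \<open>v\<close> with \<open>u k\<close>. Indexing by \<open>fst\<close> and
  \<open>snd\<close> fits triples, whose second component is the pair of the other two
  labels.\<close>

lemma psd_kronecker:
  fixes X :: "complex^'a^'a" and Y :: "complex^'p^'p"
  assumes "psd X" "psd Y"
  shows "psd (\<chi> i j. X $ fst i $ fst j * Y $ snd i $ snd j)" (is "psd ?Z")
proof -
  obtain u :: "'p \<Rightarrow> complex^'p"
    where u: "\<And>i j. Y $ i $ j = (\<Sum>k\<in>UNIV. u k $ i * cnj (u k $ j))"
    using psd_rank_one_sum[OF assms(2)] by blast
  have "sesq ?Z v v \<in> \<real>\<^sub>\<ge>\<^sub>0" for v
  proof -
    define x where "x k = (\<chi> a. \<Sum>p\<in>UNIV. cnj (u k $ p) * v $ (a, p))" for k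
    define f where "f a p b q k
      = cnj (v $ (a, p)) * X $ a $ b * u k $ p * cnj (u k $ q) * v $ (b, q)" for a p b q k
    have "sesq ?Z v v = (\<Sum>a\<in>UNIV. \<Sum>p\<in>UNIV. \<Sum>b\<in>UNIV. \<Sum>q\<in>UNIV. \<Sum>k\<in>UNIV. f a p b q k)"
      by (simp add: sesq_def sum_UNIV_pair u sum_distrib_left sum_distrib_right f_def mult.assoc)
    also have "\<dots> = (\<Sum>(a, p, b, q, k)\<in>UNIV. f a p b q k)"
      by (simp only: sum_UNIV_pair prod.case)
    also have "\<dots> = (\<Sum>(k, a, b, p, q)\<in>UNIV. f a p b q k)"
      by (rule sum.reindex_bij_witness[where i = "\<lambda>(k, a, b, p, q). (a, p, b, q, k)"
            and j = "\<lambda>(a, p, b, q, k). (k, a, b, p, q)"]) auto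
    also have "\<dots> = (\<Sum>k\<in>UNIV. \<Sum>a\<in>UNIV. \<Sum>b\<in>UNIV. \<Sum>p\<in>UNIV. \<Sum>q\<in>UNIV. f a p b q k)"
      by (simp only: sum_UNIV_pair prod.case)
    also have "\<dots> = (\<Sum>k\<in>UNIV. \<Sum>a\<in>UNIV. \<Sum>b\<in>UNIV. X $ a $ b *
        ((\<Sum>p\<in>UNIV. u k $ p * cnj (v $ (a, p))) * (\<Sum>q\<in>UNIV. cnj (u k $ q) * v $ (b, q))))"
      by (simp only: sum_product) (simp add: sum_distrib_left f_def mult_ac)
    also have "\<dots> = (\<Sum>k\<in>UNIV. sesq X (x k) (x k))"
      by (simp add: sesq_def x_def mult_ac)
    also have "\<dots> \<in> \<real>\<^sub>\<ge>\<^sub>0"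
      by (intro nonneg_Reals_sum psd_sesq[OF assms(1)])
    finally show ?thesis .
  qed
  then show ?thesis by (simp add: psd_iff_sesq)
qed

lemma psd_tensor_A_BC: "psd X \<Longrightarrow> psd Y \<Longrightarrow> psd (tensor_A_BC X Y)"
  using psd_kronecker[of X Y] by (simp add: tensor_A_BC_def case_prod_unfold)

text \<open>This is conjugation of \<open>M\<close> by \<open>K\<close> tensored with the identity;
  the adjoint of that operator is moved onto the vector, giving \<open>w\<close>.\<close>

lemma psd_kraus_left:
  fixes M :: "complex^('a::finite \<times> 'p::finite)^('a \<times> 'p)"
  assumes "psd M"
  shows "psd (\<chi> i j. \<Sum>x\<in>UNIV. \<Sum>y\<in>UNIV.
    K (fst i) x * M $ (x, snd i) $ (y, snd j) * cnj (K (fst j) y))" (is "psd ?Z")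
proof -
  have "sesq ?Z v v \<in> \<real>\<^sub>\<ge>\<^sub>0" for v
  proof -
    define w where "w = (\<chi> i. \<Sum>a\<in>UNIV. cnj (K a (fst i)) * v $ (a, snd i))"
    define f where "f a p b q x y
      = cnj (v $ (a, p)) * K a x * M $ (x, p) $ (y, q) * cnj (K b y) * v $ (b, q)" for a p b q x y
    have "sesq ?Z v v
        = (\<Sum>a\<in>UNIV. \<Sum>p\<in>UNIV. \<Sum>b\<in>UNIV. \<Sum>q\<in>UNIV. \<Sum>x\<in>UNIV. \<Sum>y\<in>UNIV. f a p b q x y)"
      by (simp add: sesq_def sum_UNIV_pair sum_distrib_left sum_distrib_right f_def mult.assoc)
    also have "\<dots> = (\<Sum>(a, p, b, q, x, y)\<in>UNIV. f a p b q x y)"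
      by (simp only: sum_UNIV_pair prod.case)
    also have "\<dots> = (\<Sum>(x, p, y, q, a, b)\<in>UNIV. f a p b q x y)"
      by (rule sum.reindex_bij_witness[where i = "\<lambda>(x, p, y, q, a, b). (a, p, b, q, x, y)"
            and j = "\<lambda>(a, p, b, q, x, y). (x, p, y, q, a, b)"]) auto
    also have "\<dots>
        = (\<Sum>x\<in>UNIV. \<Sum>p\<in>UNIV. \<Sum>y\<in>UNIV. \<Sum>q\<in>UNIV. \<Sum>a\<in>UNIV. \<Sum>b\<in>UNIV. f a p b q x y)"
      by (simp only: sum_UNIV_pair prod.case)
    also have "\<dots> = (\<Sum>x\<in>UNIV. \<Sum>p\<in>UNIV. \<Sum>y\<in>UNIV. \<Sum>q\<in>UNIV. M $ (x, p) $ (y, q) *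
        ((\<Sum>a\<in>UNIV. K a x * cnj (v $ (a, p))) * (\<Sum>b\<in>UNIV. cnj (K b y) * v $ (b, q))))"
      by (simp only: sum_product) (simp add: sum_distrib_left f_def mult_ac)
    also have "\<dots> = sesq M w w"
      by (simp add: sesq_def w_def sum_UNIV_pair mult_ac)
    also have "\<dots> \<in> \<real>\<^sub>\<ge>\<^sub>0"
      by (rule psd_sesq[OF assms])
    finally show ?thesis .
  qed
  then show ?thesis by (simp add: psd_iff_sesq)
qed

lemma psd_kraus_on_A:
  assumes "psd \<rho>"
  shows "psd (on_A (\<lambda>X. \<chi> a a'. \<Sum>x\<in>UNIV. \<Sum>y\<in>UNIV. K a x * X $ x $ y * cnj (K a' y)) \<rho>)"
  using psd_kraus_left[OF assms, of K] by (simp add: on_A_def case_prod_unfold)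

text \<open>The maps \<open>X \<mapsto> V A X A\<^sup>\<dagger> V\<^sup>\<dagger>\<close>, with \<open>A\<close> running over all \<open>|i><j| - |j><i|\<close>, add up to twice
  \<open>Tr(X) 1 - V X\<^sup>T V\<^sup>\<dagger>\<close>. The third term below projects each \<open>A\<close> off the direction of the antisymmetric
  matrix \<open>V\<^sup>\<dagger>\<close>, which accounts for subtracting \<open>X\<close> up to the remaining \<open>X / d\<close>.\<close>

definition kraus_BH :: "complex^'n^'n \<Rightarrow> 'n \<times> 'n \<Rightarrow> 'n \<Rightarrow> 'n \<Rightarrow> complex" where
  "kraus_BH V = (\<lambda>(i, j) a x. (if x = j then V $ a $ i else 0) - (if x = i then V $ a $ j else 0)
     + (if x = a then of_real (2 / real CARD('n)) * V $ i $ j else 0))"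

text \<open>Write \<open>e\<close> for 2/d. By orthonormality of the rows of \<open>V\<close>, the
  cross terms contribute \<open>- 4 e X\<close> and the square of the third term contributes
  \<open>e^2 d X = 2 e X\<close>. The value 2/d minimizes \<open>- 4 e + d e^2\<close>.\<close>

lemma kraus_BH_sum:
  fixes V X :: "complex^'n^'n"
  assumes "unitary V" "transpose V = - V"
  shows "(\<Sum>k\<in>UNIV. \<Sum>x\<in>UNIV. \<Sum>y\<in>UNIV. kraus_BH V k a x * X $ x $ y * cnj (kraus_BH V k a' y))
    = 2 * ((mat (trace X) - V ** transpose X ** adj V) $ a $ a'
        - of_real (2 / real CARD('n)) * X $ a $ a')"
proof -
  define e :: complex where "e = of_real (2 / real CARD('n))"
  have ce: "cnj e = e" by (simp add: e_def)
  have ee: "e * of_nat CARD('n) = 2" by (simp add: e_def)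
  note rows = unitary_rows[OF assms(1)]
  have anti: "V $ i $ j = - (V $ j $ i)" for i j
    by (rule antisymmetric_entry[OF assms(2)])
  have delta: "(\<Sum>x\<in>UNIV. (if x = m then c else 0) * g x) = c * g m"
    and delta': "(\<Sum>x\<in>UNIV. g x * (if x = m then c else 0)) = g m * c"
    for m :: 'n and c and g :: "'n \<Rightarrow> complex"
  proof -
    have "(\<Sum>x\<in>UNIV. (if x = m then c else 0) * g x) = (\<Sum>x\<in>UNIV. if x = m then c * g m else 0)"
      by (rule sum.cong) auto
    then show "(\<Sum>x\<in>UNIV. (if x = m then c else 0) * g x) = c * g m" by simp
    then show "(\<Sum>x\<in>UNIV. g x * (if x = m then c else 0)) = g m * c"
      by (simp add: mult.commute)
  qed
  have cnj_if: "cnj (if b then c else 0) = (if b then cnj c else 0)" for b c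
    by simp
  have l: "(\<Sum>x\<in>UNIV. kraus_BH V (i, j) a x * X $ x $ y)
      = V $ a $ i * X $ j $ y - V $ a $ j * X $ i $ y + e * V $ i $ j * X $ a $ y" for i j y
    unfolding kraus_BH_def e_def[symmetric] prod.case
    by (simp add: distrib_right left_diff_distrib sum.distrib sum_subtractf delta mult.assoc)
  have r: "(\<Sum>y\<in>UNIV. Z y * cnj (kraus_BH V (i, j) a' y))
      = Z j * cnj (V $ a' $ i) - Z i * cnj (V $ a' $ j) + e * cnj (V $ i $ j) * Z a'" for i j Z
    unfolding kraus_BH_def e_def[symmetric] prod.case
    by (simp add: distrib_left right_diff_distrib sum.distrib sum_subtractf delta' ce cnj_if
        mult_ac)
  have kk: "(\<Sum>x\<in>UNIV. \<Sum>y\<in>UNIV. kraus_BH V (i, j) a x * X $ x $ y * cnj (kraus_BH V (i, j) a' y))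
      = (V $ a $ i * X $ j $ j - V $ a $ j * X $ i $ j + e * V $ i $ j * X $ a $ j) * cnj (V $ a' $ i)
      - (V $ a $ i * X $ j $ i - V $ a $ j * X $ i $ i + e * V $ i $ j * X $ a $ i) * cnj (V $ a' $ j)
      + e * cnj (V $ i $ j) * (V $ a $ i * X $ j $ a' - V $ a $ j * X $ i $ a' + e * V $ i $ j * X $ a $ a')"
    for i j
    by (subst sum.swap) (simp only: sum_distrib_right[symmetric] l r)
  \<comment> \<open>\<open>D\<close> and \<open>T\<close> come from the two antisymmetrized terms,
    \<open>P\<close> and \<open>Q\<close> from their products with the third term, and
    \<open>N\<close> from the square of the third term.\<close>
  define D where "D = (\<Sum>i\<in>UNIV. \<Sum>j\<in>UNIV. V $ a $ i * cnj (V $ a' $ i) * X $ j $ j)"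
  define T where "T = (\<Sum>i\<in>UNIV. \<Sum>j\<in>UNIV. V $ a $ i * X $ j $ i * cnj (V $ a' $ j))"
  define P where "P = (\<Sum>i\<in>UNIV. \<Sum>j\<in>UNIV. V $ a $ i * cnj (V $ j $ i) * X $ j $ a')"
  define Q where "Q = (\<Sum>i\<in>UNIV. \<Sum>j\<in>UNIV. V $ j $ i * cnj (V $ a' $ i) * X $ a $ j)"
  define N where "N = (\<Sum>i\<in>UNIV. \<Sum>j\<in>UNIV. V $ i $ j * cnj (V $ i $ j) * X $ a $ a')"
  have D: "D = mat (trace X) $ a $ a'"
    unfolding D_def sum_product[symmetric] rows by (simp add: trace_def mat_def)
  have T: "T = (V ** transpose X ** adj V) $ a $ a'"
    unfolding T_def by (subst sum.swap)
      (simp add: matrix_matrix_mult_def transpose_def adj_def sum_distrib_right)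
  have P: "P = X $ a $ a'"
    unfolding P_def by (subst sum.swap) (simp add: sum_distrib_right[symmetric] rows delta eq_commute[of a])
  have Q: "Q = X $ a $ a'"
    unfolding Q_def by (subst sum.swap) (simp add: sum_distrib_right[symmetric] rows delta eq_commute[of a])
  have N: "N = of_nat CARD('n) * X $ a $ a'"
    unfolding N_def by (simp add: sum_distrib_right[symmetric] rows delta eq_commute[of a])
  \<comment> \<open>The other sums of the expansion arise from these by exchanging the summation
    indices or, in \<open>P2\<close> and \<open>Q2\<close>, by flipping one entry of
    \<open>V\<close> at the cost of a sign.\<close>
  have D': "(\<Sum>i\<in>UNIV. \<Sum>j\<in>UNIV. V $ a $ j * cnj (V $ a' $ j) * X $ i $ i) = D"
    unfolding D_def by (rule sum.swap)
  have T': "(\<Sum>i\<in>UNIV. \<Sum>j\<in>UNIV. V $ a $ j * X $ i $ j * cnj (V $ a' $ i)) = T"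
    unfolding T_def by (rule sum.swap)
  have P1: "(\<Sum>i\<in>UNIV. \<Sum>j\<in>UNIV. V $ a $ j * cnj (V $ i $ j) * X $ i $ a') = P"
    unfolding P_def by (rule sum.swap)
  have P2: "(\<Sum>i\<in>UNIV. \<Sum>j\<in>UNIV. V $ a $ i * cnj (V $ i $ j) * X $ j $ a') = - P"
    unfolding P_def sum_negf[symmetric] by (intro sum.cong refl) (subst anti, simp)
  have Q1: "(\<Sum>i\<in>UNIV. \<Sum>j\<in>UNIV. V $ i $ j * cnj (V $ a' $ j) * X $ a $ i) = Q"
    unfolding Q_def by (rule sum.swap)
  have Q2: "(\<Sum>i\<in>UNIV. \<Sum>j\<in>UNIV. V $ i $ j * cnj (V $ a' $ i) * X $ a $ j) = - Q"
    unfolding Q_def sum_negf[symmetric] by (intro sum.cong refl) (subst anti, simp)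
  have "(\<Sum>k\<in>UNIV. \<Sum>x\<in>UNIV. \<Sum>y\<in>UNIV. kraus_BH V k a x * X $ x $ y * cnj (kraus_BH V k a' y))
    = (\<Sum>i\<in>UNIV. \<Sum>j\<in>UNIV. \<Sum>x\<in>UNIV. \<Sum>y\<in>UNIV.
        kraus_BH V (i, j) a x * X $ x $ y * cnj (kraus_BH V (i, j) a' y))"
    by (simp only: sum_UNIV_pair)
  also have "\<dots> = (\<Sum>i\<in>UNIV. \<Sum>j\<in>UNIV.
      V $ a $ i * cnj (V $ a' $ i) * X $ j $ j + V $ a $ j * cnj (V $ a' $ j) * X $ i $ i
      - V $ a $ j * X $ i $ j * cnj (V $ a' $ i) - V $ a $ i * X $ j $ i * cnj (V $ a' $ j)
      + e * (V $ i $ j * cnj (V $ a' $ i) * X $ a $ j) - e * (V $ i $ j * cnj (V $ a' $ j) * X $ a $ i)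
      + e * (V $ a $ i * cnj (V $ i $ j) * X $ j $ a') - e * (V $ a $ j * cnj (V $ i $ j) * X $ i $ a')
      + e * e * (V $ i $ j * cnj (V $ i $ j) * X $ a $ a'))"
    unfolding kk by (intro sum.cong refl) (simp add: algebra_simps)
  also have "\<dots> = D + D - T - T - e * Q - e * Q - e * P - e * P + e * e * N"
    unfolding sum.distrib sum_subtractf sum_distrib_left[of e, symmetric]
      sum_distrib_left[of "e * e", symmetric] D' T' P1 P2 Q1 Q2
      D_def[symmetric] T_def[symmetric] N_def[symmetric] by simp
  also have "e * e * N = e * (e * of_nat CARD('n)) * X $ a $ a'"
    by (simp add: N)
  finally show ?thesis
    unfolding ee D T P Q e_def[symmetric] by (simp add: algebra_simps)
qed


text \<open>The map B + id / d is a nonnegative multiple of a sum of Kraus maps, so it stays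
  positive next to spectator parties, whatever the correlations in the operator.\<close>

lemma psd_on_A_breuer_hall_add:
  fixes V :: "complex^'n^'n" and \<rho> :: "complex^('n::finite \<times> 'b::finite \<times> 'c::finite)^('n \<times> 'b \<times> 'c)"
  assumes "unitary V" "transpose V = - V" "CARD('n) > 2" "psd \<rho>"
  shows "psd (on_A (breuer_hall V) \<rho> + (1 / real CARD('n)) *\<^sub>R \<rho>)"
proof -
  define d where "d = real CARD('n)"
  have d: "d > 2" using assms(3) by (simp add: d_def)
  \<comment> \<open>The 2 compensates for the Kraus family running over ordered pairs: exchanging
    \<open>i\<close> and \<open>j\<close> only changes the sign of the operator.\<close>
  define c where "c = 1 / (2 * (d - 2))"
  define L where "L k = (\<lambda>X :: complex^'n^'n. \<chi> a a'. \<Sum>x\<in>UNIV. \<Sum>y\<in>UNIV.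
    kraus_BH V k a x * X $ x $ y * cnj (kraus_BH V k a' y))" for k
  have L: "breuer_hall V X $ a $ a' + (1 / d) *\<^sub>R X $ a $ a'
      = c *\<^sub>R (\<Sum>k\<in>UNIV. L k X $ a $ a')" for X a a'
  proof -
    define D where "D = (mat (trace X) - V ** transpose X ** adj V) $ a $ a'"
    have K: "(\<Sum>k\<in>UNIV. L k X $ a $ a') = 2 * (D - of_real (2 / d) * X $ a $ a')"
      unfolding L_def d_def D_def using kraus_BH_sum[OF assms(1,2)] by simp
    have B: "breuer_hall V X $ a $ a' = (1 / (d - 2)) *\<^sub>R (D - X $ a $ a')"
      by (simp add: breuer_hall_def d_def D_def algebra_simps)
    \<comment> \<open>Brings \<open>X / d\<close> to the prefactor of the Breuer-Hall map, by 1 -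
      2/d = (d - 2)/d.\<close>
    have I: "(1 / d) *\<^sub>R X $ a $ a'
        = (1 / (d - 2)) *\<^sub>R (X $ a $ a' - of_real (2 / d) * X $ a $ a')"
      using d by (simp add: scaleR_conv_of_real field_simps del: of_real_diff) (simp add: algebra_simps)
    have half: "(1 / r) *\<^sub>R z = (1 / (2 * r)) *\<^sub>R (2 * z)" for r and z :: complex
      by (simp add: complex_eq_iff)
    show ?thesis
      unfolding c_def K B I half[symmetric] scaleR_add_right[symmetric] by simp
  qed
  have "on_A (breuer_hall V) \<rho> + (1 / d) *\<^sub>R \<rho> = c *\<^sub>R (\<Sum>k\<in>UNIV. on_A (L k) \<rho>)"
    using L[of "\<chi> x y. \<rho> $ (x, p) $ (y, q)" for p q] by (simp add: vec_eq_iff on_A_def)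
  moreover have "psd (\<Sum>k\<in>UNIV. on_A (L k) \<rho>)"
    unfolding L_def by (intro psd_sum psd_kraus_on_A assms(4))
  ultimately show ?thesis
    using d unfolding d_def[symmetric] by (simp add: psd_scaleR c_def)
qed

lemma psd_on_A_breuer_hall_tensor:
  fixes V :: "complex^'n^'n"
  assumes "unitary V" "transpose V = - V" "CARD('n) \<ge> 2" "psd X" "psd Y"
  shows "psd (on_A (breuer_hall V) (tensor_A_BC X Y))"
  unfolding on_A_tensor[of "breuer_hall V", OF breuer_hall_scale]
  by (intro psd_tensor_A_BC psd_breuer_hall assms)

section \<open>Transfer from party A to parties B and C by permuting the parties\<close>

definition relabel :: "('m \<Rightarrow> 'n) \<Rightarrow> complex^'n^'n \<Rightarrow> complex^'m^'m" where
  "relabel p M = (\<chi> i j. M $ p i $ p j)"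

lemma relabel_add: "relabel p (M + N) = relabel p M + relabel p N"
  by (simp add: relabel_def vec_eq_iff)

lemma relabel_scaleR: "relabel p (c *\<^sub>R M) = c *\<^sub>R relabel p M"
  by (simp add: relabel_def vec_eq_iff)

text \<open>A bijective relabelling is conjugation by a permutation; its form at \<open>v\<close> is
  the form of \<open>M\<close> at \<open>v\<close> composed with the inverse.\<close>

lemma psd_relabel:
  assumes "bij p" "psd M"
  shows "psd (relabel p M)"
  unfolding psd_iff_sesq
proof
  fix v
  have "sesq (relabel p M) v v = (\<Sum>i\<in>UNIV. \<Sum>j\<in>UNIV.
      cnj (v $ inv p (p i)) * M $ p i $ p j * v $ inv p (p j))"
    by (simp add: sesq_def relabel_def inv_f_f[OF bij_is_inj[OF assms(1)]])
  also have "\<dots> = sesq M (\<chi> i. v $ inv p i) (\<chi> i. v $ inv p i)"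
    by (simp add: sesq_def sum.reindex_bij_betw[OF assms(1),
          where g = "\<lambda>j. cnj (v $ inv p i) * M $ i $ j * v $ inv p j" for i]
        sum.reindex_bij_betw[OF assms(1),
          where g = "\<lambda>i. \<Sum>j\<in>UNIV. cnj (v $ inv p i) * M $ i $ j * v $ inv p j"])
  finally show "sesq (relabel p M) v v \<in> \<real>\<^sub>\<ge>\<^sub>0"
    using psd_sesq[OF assms(2)] by simp
qed

abbreviation BA :: "'a \<times> 'b \<times> 'c \<Rightarrow> 'b \<times> 'a \<times> 'c" where
  "BA \<equiv> \<lambda>(a, b, c). (b, a, c)"

abbreviation CAB :: "'a \<times> 'b \<times> 'c \<Rightarrow> 'c \<times> 'a \<times> 'b" where
  "CAB \<equiv> \<lambda>(a, b, c). (c, a, b)"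

abbreviation BCA :: "'a \<times> 'b \<times> 'c \<Rightarrow> 'b \<times> 'c \<times> 'a" where
  "BCA \<equiv> \<lambda>(a, b, c). (b, c, a)"

lemma bij_party_permutations: "bij BA" "bij CAB" "bij BCA"
  by (rule o_bij[of BA], auto) (rule o_bij[of BCA], auto, rule o_bij[of CAB], auto)

lemma relabel_inverse:
  "relabel BA (relabel BA M) = M" "relabel CAB (relabel BCA M) = M"
  by (simp_all add: relabel_def vec_eq_iff)

lemma on_B_eq_relabel: "on_B L \<rho> = relabel BA (on_A L (relabel BA \<rho>))"
  by (simp add: relabel_def on_A_def on_B_def vec_eq_iff)

text \<open>Since \<open>relabel\<close> pulls labels back, \<open>relabel BCA\<close> is the one
  that moves party C to the front, and \<open>relabel CAB\<close> restores the order.\<close>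

lemma on_C_eq_relabel: "on_C L \<rho> = relabel CAB (on_A L (relabel BCA \<rho>))"
  by (simp add: relabel_def on_A_def on_C_def vec_eq_iff)

lemma tensor_B_AC_eq_relabel: "tensor_B_AC X Y = relabel BA (tensor_A_BC X Y)"
  by (simp add: relabel_def tensor_A_BC_def tensor_B_AC_def vec_eq_iff)

lemma tensor_C_AB_eq_relabel: "tensor_C_AB X Y = relabel CAB (tensor_A_BC X Y)"
  by (simp add: relabel_def tensor_A_BC_def tensor_C_AB_def vec_eq_iff)

lemma psd_tensor_B_AC: "psd X \<Longrightarrow> psd Y \<Longrightarrow> psd (tensor_B_AC X Y)"
  unfolding tensor_B_AC_eq_relabel by (intro psd_relabel bij_party_permutations psd_tensor_A_BC)

lemma psd_tensor_C_AB: "psd X \<Longrightarrow> psd Y \<Longrightarrow> psd (tensor_C_AB X Y)"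
  unfolding tensor_C_AB_eq_relabel by (intro psd_relabel bij_party_permutations psd_tensor_A_BC)

lemma psd_on_B_breuer_hall_tensor:
  fixes V :: "complex^'n^'n"
  assumes "unitary V" "transpose V = - V" "CARD('n) \<ge> 2" "psd X" "psd Y"
  shows "psd (on_B (breuer_hall V) (tensor_B_AC X Y))"
  unfolding on_B_tensor[of "breuer_hall V", OF breuer_hall_scale]
  by (intro psd_tensor_B_AC psd_breuer_hall assms)

lemma psd_on_C_breuer_hall_tensor:
  fixes V :: "complex^'n^'n"
  assumes "unitary V" "transpose V = - V" "CARD('n) \<ge> 2" "psd X" "psd Y"
  shows "psd (on_C (breuer_hall V) (tensor_C_AB X Y))"
  unfolding on_C_tensor[of "breuer_hall V", OF breuer_hall_scale]
  by (intro psd_tensor_C_AB psd_breuer_hall assms)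

lemma psd_on_B_breuer_hall_add:
  fixes V :: "complex^'n^'n" and \<rho> :: "complex^('a::finite \<times> 'n \<times> 'c::finite)^('a \<times> 'n \<times> 'c)"
  assumes "unitary V" "transpose V = - V" "CARD('n) > 2" "psd \<rho>"
  shows "psd (on_B (breuer_hall V) \<rho> + (1 / real CARD('n)) *\<^sub>R \<rho>)"
  using psd_relabel[OF bij_party_permutations(1) psd_on_A_breuer_hall_add[OF assms(1-3)
        psd_relabel[OF bij_party_permutations(1) assms(4)]]]
  by (simp add: relabel_add relabel_scaleR relabel_inverse on_B_eq_relabel)

lemma psd_on_C_breuer_hall_add:
  fixes V :: "complex^'n^'n" and \<rho> :: "complex^('a::finite \<times> 'b::finite \<times> 'n)^('a \<times> 'b \<times> 'n)"
  assumes "unitary V" "transpose V = - V" "CARD('n) > 2" "psd \<rho>"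
  shows "psd (on_C (breuer_hall V) \<rho> + (1 / real CARD('n)) *\<^sub>R \<rho>)"
  using psd_relabel[OF bij_party_permutations(2) psd_on_A_breuer_hall_add[OF assms(1-3)
        psd_relabel[OF bij_party_permutations(3) assms(4)]]]
  by (simp add: relabel_add relabel_scaleR relabel_inverse on_C_eq_relabel)

section \<open>Linearity of the map and reduction to product states\<close>

lemma on_A_add:
  assumes "\<And>X Y. L (X + Y) = L X + L Y"
  shows "on_A L (\<rho> + \<sigma>) = on_A L \<rho> + on_A L \<sigma>"
proof -
  have "L (\<chi> x y. f x y + g x y) = L (\<chi> x y. f x y) + L (\<chi> x y. g x y)"
    for f g :: "'a \<Rightarrow> 'a \<Rightarrow> complex"
    unfolding assms[symmetric] by (rule arg_cong[where f = L]) (simp add: vec_eq_iff)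
  then show ?thesis by (simp add: on_A_def vec_eq_iff)
qed

lemma on_A_scaleR:
  assumes "\<And>X z. L (\<chi> x y. X $ x $ y * z) = (\<chi> x y. L X $ x $ y * z)"
  shows "on_A L (r *\<^sub>R \<rho>) = r *\<^sub>R on_A L \<rho>"
proof -
  have "L (\<chi> x y. r *\<^sub>R f x y) = (\<chi> x y. r *\<^sub>R L (\<chi> x y. f x y) $ x $ y)"
    for f :: "'a \<Rightarrow> 'a \<Rightarrow> complex"
    using assms[of "\<chi> x y. f x y" "of_real r"]
    by (simp add: scaleR_conv_of_real[where 'a = complex] mult.commute)
  then show ?thesis by (simp add: on_A_def vec_eq_iff)
qed

lemma Phi_BH_add: "Phi_BH V c (\<rho> + \<sigma>) = Phi_BH V c \<rho> + Phi_BH V c \<sigma>"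
proof -
  have "mat (trace \<rho> + trace \<sigma>) = (mat (trace \<rho>) + mat (trace \<sigma>) :: complex^('a \<times> 'a \<times> 'a)^('a \<times> 'a \<times> 'a))"
    by (simp add: vec_eq_iff mat_def)
  then show ?thesis
    by (simp add: Phi_BH_def on_B_eq_relabel on_C_eq_relabel relabel_add on_A_add breuer_hall_add
        trace_add scaleR_add_right)
qed

lemma Phi_BH_scaleR: "Phi_BH V c (r *\<^sub>R \<rho>) = r *\<^sub>R Phi_BH V c \<rho>"
proof -
  have "trace (r *\<^sub>R \<rho>) = r *\<^sub>R trace \<rho>"
    by (simp add: trace_def scaleR_sum_right)
  moreover have "mat (r *\<^sub>R trace \<rho>) = (r *\<^sub>R mat (trace \<rho>) :: complex^('a \<times> 'a \<times> 'a)^('a \<times> 'a \<times> 'a))"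
    by (simp add: vec_eq_iff mat_def)
  ultimately show ?thesis
    by (simp add: Phi_BH_def on_B_eq_relabel on_C_eq_relabel relabel_scaleR
        on_A_scaleR[OF breuer_hall_scale] scaleR_add_right mult.commute)
qed

lemma Phi_BH_sum: "Phi_BH V c (\<Sum>k\<in>S. F k) = (\<Sum>k\<in>S. Phi_BH V c (F k))"
  \<comment> \<open>Scaling by 0 shows that the zero operator is sent to zero, as the empty and
    infinite index sets require.\<close>
  using Phi_BH_scaleR[of V c 0 0]
  by (induction S rule: infinite_finite_induct) (simp_all add: Phi_BH_add)

lemma psd_Phi_BH_product_state:
  fixes V :: "complex^'n^'n" and \<rho> :: "complex^('n \<times> 'n \<times> 'n)^('n \<times> 'n \<times> 'n)"
  assumes "unitary V" "transpose V = - V" "CARD('n) > 2" "product_state \<rho>"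
  shows "psd (Phi_BH V (2 / real CARD('n)) \<rho>)"
proof -
  let ?A = "on_A (breuer_hall V) \<rho>" and ?B = "on_B (breuer_hall V) \<rho>" and ?C = "on_C (breuer_hall V) \<rho>"
  let ?e = "1 / real CARD('n)"
  have d: "CARD('n) \<ge> 2" using assms(3) by simp
  note ten = psd_on_A_breuer_hall_tensor[OF assms(1,2) d] psd_on_B_breuer_hall_tensor[OF assms(1,2) d]
    psd_on_C_breuer_hall_tensor[OF assms(1,2) d]
  \<comment> \<open>Only the party whose local term is positive is remembered, so the three
    bipartitions can be finished together.\<close>
  have "psd \<rho> \<and> (psd ?A \<or> psd ?B \<or> psd ?C)"
    using assms(4) unfolding product_state_def state_def
    by (elim disjE exE conjE) (simp_all add: ten psd_tensor_A_BC psd_tensor_B_AC psd_tensor_C_AB)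
  then have \<rho>: "psd \<rho>" and cases: "psd ?A \<or> psd ?B \<or> psd ?C"
    by blast+
  note cp = psd_on_A_breuer_hall_add[OF assms(1-3) \<rho>] psd_on_B_breuer_hall_add[OF assms(1-3) \<rho>]
    psd_on_C_breuer_hall_add[OF assms(1-3) \<rho>]
  have tr: "psd ((2 * ?e) *\<^sub>R (mat (trace \<rho>) - \<rho>))"
    by (intro psd_scaleR psd_trace_minus \<rho>) simp
  \<comment> \<open>Three groupings of the same sum: the local term known to be positive stands
    alone, the other two each receive \<open>?e *\<^sub>R \<rho>\<close>, and the trace term pays
    for both.\<close>
  have "Phi_BH V (2 * ?e) \<rho> = ?A + (?B + ?e *\<^sub>R \<rho>) + (?C + ?e *\<^sub>R \<rho>) + (2 * ?e) *\<^sub>R (mat (trace \<rho>) - \<rho>)"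
    "Phi_BH V (2 * ?e) \<rho> = ?B + (?A + ?e *\<^sub>R \<rho>) + (?C + ?e *\<^sub>R \<rho>) + (2 * ?e) *\<^sub>R (mat (trace \<rho>) - \<rho>)"
    "Phi_BH V (2 * ?e) \<rho> = ?C + (?A + ?e *\<^sub>R \<rho>) + (?B + ?e *\<^sub>R \<rho>) + (2 * ?e) *\<^sub>R (mat (trace \<rho>) - \<rho>)"
    unfolding Phi_BH_def mult_2 scaleR_add_left by (simp_all add: scaleR_diff_right)
  then have "psd (Phi_BH V (2 * ?e) \<rho>)"
    using cases cp tr by (metis psd_add)
  then show ?thesis by simp
qed

theorem theorem6:
  fixes V :: "complex^'n^'n"
    and \<rho> :: "complex^('n \<times> 'n \<times> 'n)^('n \<times> 'n \<times> 'n)"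
  assumes "CARD('n) \<ge> 4" and "even CARD('n)"
    and "unitary V" and "transpose V = - V"
    and "biseparable \<rho>"
  shows "psd (Phi_BH V (2 / real CARD('n)) \<rho>)"
proof -
  obtain m :: nat and p :: "nat \<Rightarrow> real" and \<sigma>
    where \<sigma>: "\<And>k. k < m \<Longrightarrow> 0 \<le> p k" "\<And>k. k < m \<Longrightarrow> product_state (\<sigma> k)"
      and \<rho>: "\<rho> = (\<Sum>k<m. p k *\<^sub>R \<sigma> k)"
    using assms(5) unfolding biseparable_def by blast
  have "CARD('n) > 2" using assms(1) by simp
  \<comment> \<open>By linearity the image is a combination, with nonnegative weights, of images of
    product states.\<close>
  then show ?thesis
    unfolding \<rho> Phi_BH_sum Phi_BH_scaleR using assms(3,4) \<sigma>
    by (intro psd_sum psd_scaleR psd_Phi_BH_product_state) auto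
qed

end
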